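(* Let $k\geq 4$ be an integer and let $G$ be a finite simple graph with maximum degree $\Delta\geq k$. Then: (1) if $\mathrm{mad}(G)<\frac{12}{5}$, then $\chi^l_k(G)=\left\lceil\frac{\Delta}{k-1}\right\rceil+1$; (2) if $\mathrm{mad}(G)<\frac{8}{3}$, then $\chi^l_k(G)\leq\left\lceil\frac{\Delta}{k-1}\right\rceil+2$; (3) if $\mathrm{mad}(G)<3$, then $\chi^l_k(G)\leq\left\lceil\frac{\Delta}{k-1}\right\rceil+3$.
   Context: All graphs are finite, simple and undirected. The maximum average degree of $G$ is $\mathrm{mad}(G)=\max\{2|E(H)|/|V(H)| : H\subseteq G\}$. A $k$-forested coloring of $G$ is a proper vertex coloring such that, for any two color classes, the subgraph induced by the union of these two classes is a forest of maximum degree less than $k$. If $L$ assigns to each vertex $v$ a list $L(v)$ of colors, $G$ is $k$-forested $L$-colorable if it has a $k$-forested coloring in which each vertex $v$ receives a color from $L(v)$; $G$ is $k$-forested $q$-choosable if it is $k$-forested $L$-colorable for every list assignment $L$ with $|L(v)|=q$ for all $v$. The $k$-forested choice number $\chi^l_k(G)$ is the smallest $q$ such that $G$ is $k$-forested $q$-choosable. *)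

theory Defs
  imports Complex_Main
begin

definition simple_graph :: "'a set \<Rightarrow> 'a set set \<Rightarrow> bool" where
  "simple_graph V E \<longleftrightarrow> finite V \<and> (\<forall>e\<in>E. \<exists>u v. u \<noteq> v \<and> u \<in> V \<and> v \<in> V \<and> e = {u, v})"

definition degree :: "'a set \<Rightarrow> 'a set set \<Rightarrow> 'a \<Rightarrow> nat" where
  "degree V E v = card {u \<in> V. {u, v} \<in> E}"

definition max_degree :: "'a set \<Rightarrow> 'a set set \<Rightarrow> nat" where
  "max_degree V E = Max (insert 0 (degree V E ` V))"

definition mad :: "'a set \<Rightarrow> 'a set set \<Rightarrow> real" where
  "mad V E = Max {2 * real (card F) / real (card W) | W F.
      W \<subseteq> V \<and> W \<noteq> {} \<and> F \<subseteq> E \<and> (\<forall>e\<in>F. e \<subseteq> W)}"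

definition induced_edges :: "'a set set \<Rightarrow> 'a set \<Rightarrow> 'a set set" where
  "induced_edges E W = {e \<in> E. e \<subseteq> W}"

definition is_cycle :: "'a set \<Rightarrow> 'a set set \<Rightarrow> 'a list \<Rightarrow> bool" where
  "is_cycle V E xs \<longleftrightarrow> length xs \<ge> 3 \<and> distinct xs \<and> set xs \<subseteq> V \<and>
     (\<forall>i < length xs. {xs ! i, xs ! ((i + 1) mod length xs)} \<in> E)"

definition forest :: "'a set \<Rightarrow> 'a set set \<Rightarrow> bool" where
  "forest V E \<longleftrightarrow> \<not> (\<exists>xs. is_cycle V E xs)"

definition forested_coloring :: "nat \<Rightarrow> 'a set \<Rightarrow> 'a set set \<Rightarrow> ('a \<Rightarrow> 'c) \<Rightarrow> bool" where
  "forested_coloring k V E c \<longleftrightarrow>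
     (\<forall>u\<in>V. \<forall>v\<in>V. {u, v} \<in> E \<longrightarrow> c u \<noteq> c v) \<and>
     (\<forall>i j. i \<noteq> j \<longrightarrow>
        (let W = {v \<in> V. c v = i \<or> c v = j} in
          forest W (induced_edges E W) \<and>
          (\<forall>v\<in>W. degree W (induced_edges E W) v < k)))"

definition forested_L_colorable :: "nat \<Rightarrow> 'a set \<Rightarrow> 'a set set \<Rightarrow> ('a \<Rightarrow> nat set) \<Rightarrow> bool" where
  "forested_L_colorable k V E L \<longleftrightarrow>
     (\<exists>c. (\<forall>v\<in>V. c v \<in> L v) \<and> forested_coloring k V E c)"

definition forested_choosable :: "nat \<Rightarrow> 'a set \<Rightarrow> 'a set set \<Rightarrow> nat \<Rightarrow> bool" where
  "forested_choosable k V E q \<longleftrightarrow>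
     (\<forall>L. (\<forall>v\<in>V. card (L v) = q) \<longrightarrow> forested_L_colorable k V E L)"

definition forested_choice_number :: "nat \<Rightarrow> 'a set \<Rightarrow> 'a set set \<Rightarrow> nat" where
  "forested_choice_number k V E = (LEAST q. forested_choosable k V E q)"

end

(* Saturation: a colour used k - 1 times around u is forbidden at any further neighbour of u, and
   since the degree is at most m (k - 1), where m is the ceiling of Delta / (k - 1), an uncoloured
   vertex meets at most m - 1 such colours at each neighbour. Hence a vertex subset that is minimal
   without a colouring avoids a few local configurations around its vertices of degree 2. Moving
   charge from each vertex to its neighbours of degree 2 then contradicts the bound on the average
   degree, with initial charges 5d - 12, 3d - 8 and 2d - 6 in the three cases. *)

theory Submission
  imports Defs
begin

text \<open>The forest condition is global while colors are chosen locally. A two-colored cycle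
  through a newly colored vertex passes two neighbors \<open>u\<close> and \<open>w\<close> of equal
  color, and the next vertex beyond \<open>u\<close> has the new color. So such a cycle is excluded
  if \<open>u\<close> and \<open>w\<close> differ in color, or if all colors around \<open>u\<close>
  are forbidden as well. Only vertices with at most two colored neighbors are ever added. A neighbor
  of arbitrary degree blocks up to m colors (its own and at most m - 1 saturated ones), so lists of
  size m + 1, m + 2, m + 3 allow 0, 1, 2 further forbidden colors; this decides which configurations
  are excluded in each case. The bound k \<ge> 4 enters because a vertex with at most two colored
  neighbors then saturates nothing. The three charge functions are scaled alike: a vertex of degree
  2 lacks exactly 2, and no vertex of larger degree starts negative. The lower bound in (1) is
  separate: with constant lists, pigeonhole around a vertex of maximum degree.\<close>

section \<open>Neighborhoods in induced subgraphs\<close>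

definition nbrs :: "'a set set \<Rightarrow> 'a set \<Rightarrow> 'a \<Rightarrow> 'a set" where
  "nbrs E W v = {u \<in> W. {u, v} \<in> E}"

lemma degree_eq_card_nbrs: "degree W E v = card (nbrs E W v)"
  by (simp add: degree_def nbrs_def)

lemma nbrs_sym: "u \<in> nbrs E W v \<Longrightarrow> v \<in> W \<Longrightarrow> v \<in> nbrs E W u"
  by (simp add: nbrs_def insert_commute)

lemma nbrs_mono: "W \<subseteq> W' \<Longrightarrow> nbrs E W v \<subseteq> nbrs E W' v"
  by (auto simp: nbrs_def)

lemma finite_nbrs: "finite W \<Longrightarrow> finite (nbrs E W v)"
  by (simp add: nbrs_def)

lemma simple_graph_no_loop: "simple_graph V E \<Longrightarrow> {v} \<notin> E"
  unfolding simple_graph_def by (metis doubleton_eq_iff insert_absorb2)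

lemma simple_graph_finite: "simple_graph V E \<Longrightarrow> finite V"
  by (simp add: simple_graph_def)

lemma simple_graph_finite_edges: "simple_graph V E \<Longrightarrow> finite E"
  unfolding simple_graph_def by (rule finite_subset[of _ "Pow V"]) auto

subsection \<open>Cycles\<close>

lemma is_cycle_subset: "is_cycle W E xs \<Longrightarrow> set xs \<subseteq> W' \<Longrightarrow> is_cycle W' E xs"
  by (simp add: is_cycle_def)

lemma is_cycle_rotate:
  assumes "is_cycle W E xs"
  shows "is_cycle W E (rotate p xs)"
proof -
  have "{rotate p xs ! i, rotate p xs ! ((i + 1) mod length xs)} \<in> E" if "i < length xs" for i
  proof -
    have pos: "0 < length xs"
      by (rule le_less_trans[OF le0 that])
    have "(p + (i + 1) mod length xs) mod length xs = ((p + i) mod length xs + 1) mod length xs"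
      by (simp add: mod_simps add.assoc)
    then have "rotate p xs ! ((i + 1) mod length xs) = xs ! (((p + i) mod length xs + 1) mod length xs)"
      using pos by (simp add: nth_rotate)
    moreover have "rotate p xs ! i = xs ! ((p + i) mod length xs)"
      using that by (simp add: nth_rotate)
    ultimately show ?thesis
      using assms pos unfolding is_cycle_def by simp
  qed
  then show ?thesis
    using assms by (simp add: is_cycle_def)
qed

text \<open>All that the extension step uses of a cycle: the two neighbors of \<open>v\<close> on it
  and the vertices after them. Short cycles are included, so \<open>y\<close> and \<open>z\<close>
  need not be new: in a triangle \<open>y\<close> is \<open>w\<close> and \<open>z\<close> is
  \<open>u\<close>, in a 4-cycle \<open>y = z\<close>.\<close>

lemma is_cycle_through:
  assumes "is_cycle W E xs" and "v \<in> set xs"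
  obtains u w y z where "u \<noteq> w" "u \<in> nbrs E W v" "w \<in> nbrs E W v"
    "y \<in> nbrs E W u" "z \<in> nbrs E W w" "y \<noteq> v" "z \<noteq> v"
proof -
  obtain p where p: "p < length xs" "xs ! p = v"
    using assms(2) by (auto simp: in_set_conv_nth)
  define ys where "ys = rotate p xs"
  have cyc: "is_cycle W E ys"
    unfolding ys_def by (rule is_cycle_rotate[OF assms(1)])
  define n where "n = length ys"
  have n: "n \<ge> 3"
    using cyc by (simp add: is_cycle_def n_def)
  have hd: "ys ! 0 = v"
  proof -
    have "0 < length xs" by (rule le_less_trans[OF le0 p(1)])
    then show ?thesis using p nth_rotate[of 0 xs p] by (simp add: ys_def)
  qed
  have dist: "i < n \<Longrightarrow> j < n \<Longrightarrow> ys ! i = ys ! j \<longleftrightarrow> i = j" for i j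
    using cyc by (simp add: is_cycle_def n_def nth_eq_iff_index_eq)
  have mem: "i < n \<Longrightarrow> ys ! i \<in> W" for i
    using cyc by (auto simp: is_cycle_def n_def)
  have edge: "{ys ! i, ys ! ((i + 1) mod n)} \<in> E" if "i < n" for i
    using cyc that by (simp add: is_cycle_def n_def)
  have e0: "{ys ! 0, ys ! 1} \<in> E"
    using edge[of 0] n by simp
  have e1: "{ys ! 1, ys ! 2} \<in> E"
    using edge[of 1] n by (simp add: numeral_2_eq_2)
  have e2: "{ys ! (n - 2), ys ! (n - 1)} \<in> E"
  proof -
    have "n - 2 + 1 = n - 1" using n by simp
    then show ?thesis using edge[of "n - 2"] n by simp
  qed
  have e3: "{ys ! (n - 1), ys ! 0} \<in> E"
    using edge[of "n - 1"] n by simp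
  show ?thesis
  proof (rule that[of "ys ! 1" "ys ! (n - 1)" "ys ! 2" "ys ! (n - 2)"])
    show "ys ! 1 \<noteq> ys ! (n - 1)" "ys ! 2 \<noteq> v" "ys ! (n - 2) \<noteq> v"
      using dist[of 1 "n - 1"] dist[of 2 0] dist[of "n - 2" 0] n hd by auto
  qed (use n e0 e1 e2 e3 mem hd in \<open>auto simp: nbrs_def insert_commute\<close>)
qed

section \<open>Forested colorings in terms of neighborhoods\<close>

lemma forest_induced_edges: "forest W (induced_edges E W) \<longleftrightarrow> forest W E"
proof -
  have "is_cycle W (induced_edges E W) xs \<longleftrightarrow> is_cycle W E xs" for xs
  proof
    assume c: "is_cycle W E xs"
    have "xs ! i \<in> W \<and> xs ! ((i + 1) mod length xs) \<in> W" if "i < length xs" for i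
    proof -
      have "(i + 1) mod length xs < length xs"
        using le_less_trans[OF le0 that] by (rule mod_less_divisor)
      then show ?thesis
        using c that unfolding is_cycle_def by (meson nth_mem subsetD)
    qed
    then show "is_cycle W (induced_edges E W) xs"
      using c by (simp add: is_cycle_def induced_edges_def)
  qed (simp add: is_cycle_def induced_edges_def)
  then show ?thesis
    by (simp add: forest_def)
qed

text \<open>Turns the degree condition on two-colored subgraphs into a count of equally colored
  neighbors, which is what changes when one vertex is added.\<close>

lemma forested_coloring_iff:
  assumes fin: "finite W" and k: "k > 0"
  shows "forested_coloring k W E c \<longleftrightarrow>
    (\<forall>v\<in>W. \<forall>u\<in>nbrs E W v. c u \<noteq> c v) \<and>
    (\<forall>i j. i \<noteq> j \<longrightarrow> forest {v \<in> W. c v = i \<or> c v = j} E) \<and>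
    (\<forall>v\<in>W. \<forall>b. card {u \<in> nbrs E W v. c u = b} < k)"
    (is "_ \<longleftrightarrow> ?P \<and> ?F \<and> ?B")
proof -
  define B where "B i j = {v \<in> W. c v = i \<or> c v = j}" for i j
  have P: "(\<forall>u\<in>W. \<forall>v\<in>W. {u, v} \<in> E \<longrightarrow> c u \<noteq> c v) \<longleftrightarrow> ?P"
    by (auto simp: nbrs_def)
  \<comment> \<open>By properness the neighbors of \<open>v\<close> inside the two classes all have
    the other color.\<close>
  have deg: "degree (B i j) (induced_edges E (B i j)) v = card {u \<in> nbrs E W v. c u = j}"
    if "?P" "v \<in> W" "c v = i" "i \<noteq> j" for i j v
  proof -
    have "{u \<in> B i j. {u, v} \<in> induced_edges E (B i j)} = {u \<in> nbrs E W v. c u = j}"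
      using that by (auto simp: B_def induced_edges_def nbrs_def)
    then show ?thesis by (simp add: degree_def)
  qed
  have comm: "B i j = B j i" for i j
    by (auto simp: B_def)
  have D: "(\<forall>i j. i \<noteq> j \<longrightarrow> (\<forall>v\<in>B i j. degree (B i j) (induced_edges E (B i j)) v < k)) \<longleftrightarrow> ?B"
    (is "?D \<longleftrightarrow> _") if P: "?P"
  proof
    assume D: ?D
    show ?B
    proof (intro ballI allI)
      fix v b assume v: "v \<in> W"
      show "card {u \<in> nbrs E W v. c u = b} < k"
      proof (cases "b = c v")
        case True
        \<comment> \<open>The color of \<open>v\<close> itself is no color of the other class; here
          the count is 0, and \<open>k > 0\<close> suffices.\<close>
        then have "{u \<in> nbrs E W v. c u = b} = {}"
          using P v by auto
        then show ?thesis using k by (metis card.empty)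
      next
        case False
        have "v \<in> B (c v) b"
          using v by (simp add: B_def)
        moreover have ne: "c v \<noteq> b" using False by simp
        ultimately have "degree (B (c v) b) (induced_edges E (B (c v) b)) v < k"
          using D by blast
        then show ?thesis
          unfolding deg[OF P v refl ne] .
      qed
    qed
  next
    assume B: ?B
    show ?D
    proof (intro allI impI ballI)
      fix i j v assume ij: "i \<noteq> j" and v: "v \<in> B i j"
      then consider "c v = i" "v \<in> W" | "c v = j" "v \<in> W"
        by (auto simp: B_def)
      then show "degree (B i j) (induced_edges E (B i j)) v < k"
      proof cases
        case 1 then show ?thesis using deg[OF P _ _ ij] B by simp
      next
        case 2 then show ?thesis using deg[OF P, of v j i] ij B by (simp add: comm[of i j])
      qed
    qed
  qed
  have fc: "forested_coloring k W E c \<longleftrightarrow> ?P \<and> ((\<forall>i j. i \<noteq> j \<longrightarrow> forest (B i j) E) \<and>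
    (\<forall>i j. i \<noteq> j \<longrightarrow> (\<forall>v\<in>B i j. degree (B i j) (induced_edges E (B i j)) v < k)))"
    unfolding forested_coloring_def P Let_def forest_induced_edges B_def[symmetric]
    by (simp only: imp_conjR all_conj_distrib)
  show ?thesis
  proof (cases ?P)
    case True
    show ?thesis unfolding fc D[OF True] by (simp only: B_def)
  next
    case False
    then show ?thesis unfolding fc by (simp only: simp_thms)
  qed
qed

subsection \<open>Extending a coloring to one more vertex\<close>

definition saturated :: "nat \<Rightarrow> 'a set set \<Rightarrow> 'a set \<Rightarrow> ('a \<Rightarrow> 'c) \<Rightarrow> 'a \<Rightarrow> 'c set" where
  "saturated k E W c u = {b. k - 1 \<le> card {y \<in> nbrs E W u. c y = b}}"

text \<open>Double counting: the color classes inside the neighborhood are disjoint, and each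
  saturated color takes at least \<open>k - 1\<close> places. As \<open>k - 1 > 0\<close>, saturated
  colors do occur around \<open>u\<close>, so there are finitely many.\<close>

lemma card_saturated_less:
  assumes fin: "finite W" and k: "k \<ge> 2" and lt: "card (nbrs E W u) < j * (k - 1)"
  shows "finite (saturated k E W c u) \<and> card (saturated k E W c u) < j"
proof -
  let ?N = "nbrs E W u" and ?S = "saturated k E W c u"
  have finN: "finite ?N" by (rule finite_nbrs[OF fin])
  have sub: "?S \<subseteq> c ` ?N"
  proof
    fix b assume "b \<in> ?S"
    then have "card {y \<in> ?N. c y = b} \<noteq> 0"
      using k by (simp add: saturated_def)
    then have "{y \<in> ?N. c y = b} \<noteq> {}" by (metis card.empty)
    then show "b \<in> c ` ?N" by auto
  qed
  then have finS: "finite ?S"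
    using finN finite_surj by blast
  have "card ?S * (k - 1) \<le> (\<Sum>b\<in>?S. card {y \<in> ?N. c y = b})"
    using sum_bounded_below[of ?S "k - 1" "\<lambda>b. card {y \<in> ?N. c y = b}"]
    by (simp add: saturated_def)
  also have "\<dots> = card (\<Union>b\<in>?S. {y \<in> ?N. c y = b})"
    by (rule card_UN_disjoint[symmetric]) (use finS finN in auto)
  also have "\<dots> \<le> card ?N"
    by (rule card_mono) (use finN in auto)
  finally have "card ?S * (k - 1) < j * (k - 1)"
    using lt by (rule le_less_trans)
  then have "card ?S < j"
    by (rule mult_right_less_imp_less) simp
  then show ?thesis
    using finS by simp
qed

text \<open>Colors alternate on a two-colored cycle, so one through \<open>v\<close> gives
  \<open>u\<close> and \<open>w\<close> the same color and has a vertex of color \<open>b\<close>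
  next to each of them, other than \<open>v\<close>. Hence it is enough to keep \<open>b\<close>
  away from the colors around \<open>u\<close>. The hypothesis \<open>free\<close> covers properness
  and the degrees at the neighbors; \<open>v\<close> itself has at most two neighbors, fewer than
  \<open>k\<close>.\<close>

lemma forested_coloring_insert:
  assumes graph: "simple_graph V E" and fin: "finite W" and k: "k \<ge> 3"
    and col: "forested_coloring k W E c" and v: "v \<notin> W"
    and nb: "nbrs E W v \<subseteq> {u, w}"
    and free: "\<And>y. y \<in> nbrs E W v \<Longrightarrow> b \<noteq> c y \<and> b \<notin> saturated k E W c y"
    and cyc: "c u = c w \<Longrightarrow> u \<noteq> w \<Longrightarrow> b \<notin> c ` nbrs E W u"
  shows "forested_coloring k (insert v W) E (c(v := b))"
proof -
  let ?c = "c(v := b)" and ?W = "insert v W"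
  have k0: "k > 0" using k by simp
  note col' = col[unfolded forested_coloring_iff[OF fin k0]]
  have vv: "{v} \<notin> E" by (rule simple_graph_no_loop[OF graph])
  have nbv: "nbrs E ?W v = nbrs E W v"
    using vv by (auto simp: nbrs_def)
  have nby: "nbrs E ?W y = (if y \<in> nbrs E W v then insert v (nbrs E W y) else nbrs E W y)"
    if "y \<in> W" for y
    using that by (auto simp: nbrs_def insert_commute)
  have nbW: "v \<notin> nbrs E W y" for y
    using v by (simp add: nbrs_def)
  have proper: "?c x \<noteq> ?c y" if "y \<in> ?W" "x \<in> nbrs E ?W y" for x y
  proof (cases "y = v")
    case True
    then show ?thesis using that free[of x] nbv nbW by (auto split: if_splits)
  next
    case False
    then show ?thesis
      using that nby[of y] col' free[of y] nbW[of y] by (auto split: if_splits)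
  qed
  have bound: "card {x \<in> nbrs E ?W y. ?c x = a} < k" if "y \<in> ?W" for y a
  proof (cases "y = v")
    case True
    have "{x \<in> nbrs E ?W y. ?c x = a} \<subseteq> {u, w}"
      using True nbv nb by auto
    then have "card {x \<in> nbrs E ?W y. ?c x = a} \<le> card {u, w}"
      by (intro card_mono) auto
    also have "\<dots> \<le> 2" by (simp add: card_insert_if)
    finally show ?thesis using k by simp
  next
    case False
    then have y: "y \<in> W" using that by simp
    have old: "card {x \<in> nbrs E W y. c x = a} < k"
      using col' y by blast
    have finy: "finite {x \<in> nbrs E W y. c x = a}"
      using finite_nbrs[OF fin] by simp
    show ?thesis
    proof (cases "y \<in> nbrs E W v \<and> a = b")
      case True
      have "{x \<in> nbrs E ?W y. ?c x = a} = insert v {x \<in> nbrs E W y. c x = a}"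
        using True nby[OF y] v nbW by auto
      moreover have "card {x \<in> nbrs E W y. c x = a} < k - 1"
        using free[of y] True by (simp add: saturated_def)
      ultimately show ?thesis
        using card_insert_le_m1[of k "{x \<in> nbrs E W y. c x = a}" v] finy nbW[of y] k
        by (simp add: card_insert_if)
    next
      case False
      have "{x \<in> nbrs E ?W y. ?c x = a} = {x \<in> nbrs E W y. c x = a}"
        using False nby[OF y] nbW[of y] by auto
      then show ?thesis using old by simp
    qed
  qed
  have forest: "forest {x \<in> ?W. ?c x = i \<or> ?c x = j} E" if "i \<noteq> j" for i j
    unfolding forest_def
  proof
    let ?B = "{x \<in> ?W. ?c x = i \<or> ?c x = j}"
    assume "\<exists>xs. is_cycle ?B E xs"
    then obtain xs where xs: "is_cycle ?B E xs" ..
    show False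
    proof (cases "v \<in> set xs")
      case False
      have "x \<in> {x \<in> W. c x = i \<or> c x = j}" if x: "x \<in> set xs" for x
      proof -
        have "x \<in> ?B" using xs x unfolding is_cycle_def by blast
        moreover have "x \<noteq> v" using x False by blast
        ultimately show ?thesis by simp
      qed
      then have "set xs \<subseteq> {x \<in> W. c x = i \<or> c x = j}"
        by blast
      then have "is_cycle {x \<in> W. c x = i \<or> c x = j} E xs"
        by (rule is_cycle_subset[OF xs])
      then show False
        using col' that by (auto simp: forest_def)
    next
      case True
      obtain p q y z where c:
        "p \<noteq> q" "p \<in> nbrs E ?B v" "q \<in> nbrs E ?B v"
        "y \<in> nbrs E ?B p" "z \<in> nbrs E ?B q" "y \<noteq> v" "z \<noteq> v"
        by (rule is_cycle_through[OF xs True])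
      have vB: "v \<in> ?B"
        using True xs by (auto simp: is_cycle_def)
      have sub: "nbrs E ?B x \<subseteq> nbrs E ?W x" for x
        by (rule nbrs_mono) auto
      have pq: "p \<in> nbrs E W v" "q \<in> nbrs E W v"
        using c(2,3) sub nbv by auto
      then have pqW: "p \<in> W" "q \<in> W" "p \<noteq> v" "q \<noteq> v"
        using v by (auto simp: nbrs_def)
      have "?c p \<noteq> ?c v" "?c q \<noteq> ?c v" "?c y \<noteq> ?c p" "?c z \<noteq> ?c q"
        using proper[of v p] proper[of v q] proper[of p y] proper[of q z] c sub pqW by auto
      moreover have "?c x = i \<or> ?c x = j" if "x \<in> nbrs E ?B t" for x t
        using that by (simp add: nbrs_def)
      note this[OF c(2)] this[OF c(3)] this[OF c(4)] this[OF c(5)]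
      moreover have "?c v = i \<or> ?c v = j" using vB by blast
      ultimately have cols: "?c p = ?c q" "?c y = b" "?c z = b"
        using that by (auto split: if_splits)
      have yz: "y \<in> nbrs E W p" "z \<in> nbrs E W q"
        using c(4-7) by (auto simp: nbrs_def)
      \<comment> \<open>Both sides are recorded because the cycle may meet \<open>u\<close> as
        \<open>p\<close> or as \<open>q\<close>, while \<open>cyc\<close> speaks of \<open>u\<close>
        only.\<close>
      have img: "b \<in> c ` nbrs E W p" "b \<in> c ` nbrs E W q"
        using yz cols c(6,7) by (auto intro!: rev_image_eqI)
      have eq: "c p = c q"
        using cols(1) pqW by simp
      from pq nb c(1) consider "u = p" "w = q" | "u = q" "w = p"
        by auto
      then show False
      proof cases
        case 1
        then show ?thesis using cyc[unfolded 1] eq c(1) img(1) by blast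
      next
        case 2
        then show ?thesis using cyc[unfolded 2] eq[symmetric] c(1) img(2) by blast
      qed
    qed
  qed
  have fin': "finite ?W" using fin by simp
  show ?thesis
    unfolding forested_coloring_iff[OF fin' k0]
    using proper bound forest by blast
qed

subsection \<open>List colorings\<close>

text \<open>\<open>m\<close> plays the role of the ceiling of Delta / (k - 1), but only the degree
  bound that it provides is assumed. The bound concerns all of \<open>V\<close>, so it stays
  available at every partially colored subset.\<close>

locale list_instance =
  fixes V :: "'a set" and E :: "'a set set" and k m q :: nat and L :: "'a \<Rightarrow> 'c set"
  assumes graph: "simple_graph V E" and k4: "k \<ge> 4" and m1: "m \<ge> 1" and mq: "m < q"
    and deg: "v \<in> V \<Longrightarrow> card (nbrs E V v) \<le> m * (k - 1)"
    and lists: "v \<in> V \<Longrightarrow> card (L v) = q"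
begin

definition lcol :: "'a set \<Rightarrow> ('a \<Rightarrow> 'c) \<Rightarrow> bool" where
  "lcol W c \<longleftrightarrow> (\<forall>v\<in>W. c v \<in> L v) \<and> forested_coloring k W E c"

abbreviation colorable :: "'a set \<Rightarrow> bool" where
  "colorable W \<equiv> \<exists>c. lcol W c"

lemma finite_sub: "W \<subseteq> V \<Longrightarrow> finite W"
  using finite_subset simple_graph_finite[OF graph] by blast

lemma finite_nbrs_sub: "W \<subseteq> V \<Longrightarrow> finite (nbrs E W u)"
  by (simp add: finite_nbrs finite_sub)

lemma not_self: "v \<notin> nbrs E W v"
  using simple_graph_no_loop[OF graph] by (simp add: nbrs_def)

text \<open>Common form of the extension steps: collect all forbidden colors in a set smaller than
  the lists.\<close>

lemma extend:
  assumes col: "lcol W c" and W: "W \<subseteq> V" and v: "v \<in> V - W"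
    and F: "finite F" "card F < q"
    and free: "\<And>y. y \<in> nbrs E W v \<Longrightarrow> c y \<in> F \<and> saturated k E W c y \<subseteq> F"
    and nb: "nbrs E W v \<subseteq> {u, w}"
    and cyc: "c u = c w \<Longrightarrow> u \<noteq> w \<Longrightarrow> c ` nbrs E W u \<subseteq> F"
  obtains b where "b \<in> L v - F" "lcol (insert v W) (c(v := b))"
proof -
  have "\<not> L v \<subseteq> F"
    using F lists[of v] v card_mono[of F "L v"] by auto
  then obtain b where b: "b \<in> L v - F" by auto
  have "forested_coloring k (insert v W) E (c(v := b))"
    by (rule forested_coloring_insert[OF graph finite_sub[OF W] _ _ _ nb])
      (use k4 col v free cyc b in \<open>auto simp: lcol_def\<close>)
  then show thesis
    using that[OF b] col b by (auto simp: lcol_def)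
qed

text \<open>The uncolored \<open>v\<close> occupies one of the at most \<open>m * (k - 1)\<close>
  places around \<open>u\<close>; this makes the count strict and leaves at most
  \<open>m - 1\<close> saturated colors.\<close>

lemma card_saturated_neighbour:
  assumes W: "W \<subseteq> V" and v: "v \<in> V - W" and u: "u \<in> nbrs E W v"
  shows "finite (saturated k E W c u)" "card (saturated k E W c u) < m"
proof -
  have "u \<in> V" using u W by (auto simp: nbrs_def)
  have "v \<in> nbrs E V u" "v \<notin> nbrs E W u"
    using u v by (auto simp: nbrs_def insert_commute)
  then have "nbrs E W u \<subset> nbrs E V u"
    using nbrs_mono[OF W] by blast
  then have "card (nbrs E W u) < card (nbrs E V u)"
    using finite_nbrs_sub[of V] psubset_card_mono by blast
  then have "card (nbrs E W u) < m * (k - 1)"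
    using deg[OF \<open>u \<in> V\<close>] by simp
  then show "finite (saturated k E W c u)" "card (saturated k E W c u) < m"
    using card_saturated_less[OF finite_sub[OF W], of k E u m c] k4 by auto
qed

text \<open>The single neighbor blocks at most 1 + (m - 1) colors. The extra set \<open>F\<close>
  lets the caller steer the new color away from colors that matter later.\<close>

lemma extend_leaf:
  assumes col: "lcol W c" and W: "W \<subseteq> V" and v: "v \<in> V - W" and nb: "nbrs E W v \<subseteq> {x}"
    and F: "finite F" "card F + m < q"
  obtains b where "b \<in> L v - F" "lcol (insert v W) (c(v := b))"
proof -
  \<comment> \<open>The bound on saturated colors is available only if \<open>x\<close> really is a
    neighbor.\<close>
  let ?S = "if x \<in> nbrs E W v then insert (c x) (saturated k E W c x) else {}"
  have S: "finite ?S \<and> card ?S \<le> m"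
    using card_saturated_neighbour[OF W v, of x c] by (auto simp: card_insert_if)
  then have card: "card (F \<union> ?S) < q"
    using F(2) card_Un_le[of F ?S] by linarith
  show thesis
  proof (rule extend[OF col W v _ card])
    show "finite (F \<union> ?S)"
      using F(1) S by blast
    show "nbrs E W v \<subseteq> {x, x}"
      using nb by blast
    show "c y \<in> F \<union> ?S \<and> saturated k E W c y \<subseteq> F \<union> ?S" if "y \<in> nbrs E W v" for y
      using that nb by auto
  qed (use that in blast)+
qed

text \<open>\<open>F\<close> holds what is forbidden on account of \<open>u\<close>;
  \<open>w\<close> adds its color and at most \<open>m - 1\<close> saturated ones. Measuring
  \<open>insert (c w) F\<close> instead of \<open>F\<close> avoids paying twice when
  \<open>u\<close> and \<open>w\<close> share a color.\<close>

lemma extend_path: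
  assumes col: "lcol W c" and W: "W \<subseteq> V" and v: "v \<in> V - W" and nb: "nbrs E W v \<subseteq> {u, w}"
    and F: "finite F" "card (insert (c w) F) + m \<le> q"
    and u: "c u \<in> F" "saturated k E W c u \<subseteq> F"
    and cyc: "c u = c w \<Longrightarrow> u \<noteq> w \<Longrightarrow> c ` nbrs E W u \<subseteq> F"
  obtains b where "lcol (insert v W) (c(v := b))"
proof -
  let ?S = "if w \<in> nbrs E W v then saturated k E W c w else {}"
  have S: "finite ?S \<and> card ?S < m"
    using card_saturated_neighbour[OF W v, of w c] m1 by auto
  then have card: "card (insert (c w) F \<union> ?S) < q"
    using F(2) card_Un_le[of "insert (c w) F" ?S] by linarith
  show thesis
  proof (rule extend[OF col W v _ card _ nb])
    show "finite (insert (c w) F \<union> ?S)"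
      using F(1) S by blast
    show "c y \<in> insert (c w) F \<union> ?S \<and> saturated k E W c y \<subseteq> insert (c w) F \<union> ?S"
      if "y \<in> nbrs E W v" for y
      using that nb u by auto
  qed (use cyc that in blast)+
qed

text \<open>Different colors at \<open>u\<close> and \<open>w\<close> rule out a two-colored cycle,
  so only 1 + (j - 1) colors at \<open>u\<close> and 1 + (m - 1) at \<open>w\<close> are
  forbidden.\<close>

lemma extend_path_distinct:
  assumes col: "lcol W c" and W: "W \<subseteq> V" and v: "v \<in> V - W" and nb: "nbrs E W v \<subseteq> {u, w}"
    and ne: "c u \<noteq> c w" and lt: "card (nbrs E W u) < j * (k - 1)" and q: "m + j + 1 \<le> q"
  obtains b where "lcol (insert v W) (c(v := b))"
proof -
  let ?F = "insert (c u) (saturated k E W c u)"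
  have S: "finite (saturated k E W c u)" "card (saturated k E W c u) < j"
    using card_saturated_less[OF finite_sub[OF W] _ lt] k4 by auto
  have "card (insert (c w) ?F) \<le> card (saturated k E W c u) + 2"
    using S by (simp add: card_insert_if)
  then have card: "card (insert (c w) ?F) + m \<le> q"
    using S q by linarith
  show thesis
    by (rule extend_path[OF col W v nb _ card]) (use S(1) ne that in blast)+
qed

text \<open>With fewer than three colored neighbors, \<open>u\<close> saturates nothing. If
  \<open>u\<close> and \<open>w\<close> have the same color, that color and the fewer than
  \<open>r\<close> colors around \<open>u\<close> make at most \<open>r\<close>, and
  \<open>w\<close> adds at most \<open>m - 1\<close>. Otherwise the two colors replace these, which
  \<open>2 \<le> r\<close> affords.\<close>

lemma extend_path_light:
  assumes col: "lcol W c" and W: "W \<subseteq> V" and v: "v \<in> V - W" and nb: "nbrs E W v \<subseteq> {u, w}"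
    and r: "card (nbrs E W u) < r" "2 \<le> r" "r \<le> 3" and q: "m + r \<le> q"
  obtains b where "lcol (insert v W) (c(v := b))"
proof (cases "c u = c w")
  case False
  show thesis
    by (rule extend_path_distinct[OF col W v nb False, of 1])
      (use r q k4 that in auto)
next
  case True
  let ?F = "insert (c u) (c ` nbrs E W u)"
  have "card (saturated k E W c u) < 1 \<and> finite (saturated k E W c u)"
    using card_saturated_less[OF finite_sub[OF W], of k E u 1 c] k4 r by auto
  then have S: "saturated k E W c u = {}" by (metis card_0_eq less_one)
  have "card ?F \<le> Suc (card (c ` nbrs E W u))"
    by (rule card_insert_le_m1) auto
  then have "card ?F \<le> r"
    using card_image_le[OF finite_nbrs_sub[OF W], of c u] r by linarith
  moreover have eq: "insert (c w) ?F = ?F"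
    using True by auto
  ultimately have card: "card (insert (c w) ?F) + m \<le> q"
    unfolding eq using q by linarith
  show thesis
  proof (rule extend_path[OF col W v nb _ card])
    show "finite ?F"
      using finite_nbrs_sub[OF W] by blast
  qed (use S that in blast)+
qed

text \<open>The vertices of \<open>T\<close> are added one at a time. Each still missing vertex
  leaves room at \<open>u\<close> below its final degree, which gives the strict bound needed. As
  \<open>f v\<close> lies outside \<open>T\<close>, it is never recolored and stays different from
  \<open>u\<close>.\<close>

lemma extend_leaves:
  assumes "finite T" "T \<inter> W = {}" "W \<union> T \<subseteq> V" "u \<in> W" "lcol W c"
    and "\<And>v. v \<in> T \<Longrightarrow> u \<in> nbrs E (W \<union> T) v \<and> nbrs E (W \<union> T) v \<subseteq> {u, f v} \<and> f v \<notin> T \<and> c u \<noteq> c (f v)"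
    and "card (nbrs E (W \<union> T) u) \<le> j * (k - 1)" and q: "m + j + 1 \<le> q"
  shows "colorable (W \<union> T)"
  using assms(1-7)
proof (induction T arbitrary: W c rule: finite_induct)
  case empty
  from empty.prems(4) show ?case by auto
next
  case (insert v T)
  let ?X = "W \<union> insert v T"
  have v: "u \<in> nbrs E ?X v" "nbrs E ?X v \<subseteq> {u, f v}" "c u \<noteq> c (f v)"
    using insert.prems(5)[of v] by auto
  have vV: "v \<in> V - W" and WV: "W \<subseteq> V" and XV: "?X \<subseteq> V"
    using insert.prems by auto
  have "v \<in> nbrs E ?X u" "v \<notin> nbrs E W u"
    using nbrs_sym[OF v(1)] vV by (auto simp: nbrs_def)
  moreover have "nbrs E W u \<subseteq> nbrs E ?X u"
    by (rule nbrs_mono) auto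
  ultimately have "nbrs E W u \<subset> nbrs E ?X u" by blast
  then have lt: "card (nbrs E W u) < j * (k - 1)"
    using psubset_card_mono[OF finite_nbrs_sub[OF XV]] insert.prems(6) by (meson less_le_trans)
  have nb: "nbrs E W v \<subseteq> {u, f v}"
    using v(2) nbrs_mono[of W ?X E v] by blast
  obtain b where b: "lcol (insert v W) (c(v := b))"
    by (rule extend_path_distinct[OF insert.prems(4) WV vV nb v(3) lt q])
  have eq: "insert v W \<union> T = ?X" by auto
  have "u \<noteq> v" using insert.prems by auto
  have "colorable (insert v W \<union> T)"
  proof (rule insert.IH[where c = "c(v := b)"])
    fix t assume t: "t \<in> T"
    show "u \<in> nbrs E (insert v W \<union> T) t \<and> nbrs E (insert v W \<union> T) t \<subseteq> {u, f t} \<and> f t \<notin> T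
       \<and> (c(v := b)) u \<noteq> (c(v := b)) (f t)"
      using insert.prems(5)[of t] t \<open>u \<noteq> v\<close> unfolding eq by auto
  next
    show "card (nbrs E (insert v W \<union> T) u) \<le> j * (k - 1)"
      using insert.prems(6) by (simp only: eq)
    show "lcol (insert v W) (c(v := b))" by (fact b)
  qed (use insert.prems(1-3) insert.hyps in auto)
  then show ?case by (simp only: eq)
qed

subsection \<open>Reducible configurations\<close>

definition critical :: "'a set \<Rightarrow> bool" where
  "critical W \<longleftrightarrow> W \<subseteq> V \<and> \<not> colorable W \<and> (\<forall>W'. W' \<subset> W \<longrightarrow> colorable W')"

lemma critical_exists:
  assumes "\<not> colorable V"
  obtains W where "critical W" "W \<noteq> {}"
proof -
  obtain W where W: "W \<subseteq> V \<and> \<not> colorable W"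
      and least: "\<And>W'. W' \<subseteq> V \<and> \<not> colorable W' \<Longrightarrow> card W \<le> card W'"
    using ex_has_least_nat[of "\<lambda>W. W \<subseteq> V \<and> \<not> colorable W" V card] assms by blast
  have "colorable W'" if "W' \<subset> W" for W'
  proof (rule ccontr)
    assume "\<not> colorable W'"
    then have "card W \<le> card W'"
      using W that by (intro least) blast
    moreover have "card W' < card W"
      using that W finite_sub by (intro psubset_card_mono) auto
    ultimately show False by simp
  qed
  then have crit: "critical W"
    using W by (simp add: critical_def)
  have "lcol {} c" for c
    by (simp add: lcol_def forested_coloring_def forest_def is_cycle_def)
  then have "W \<noteq> {}" using W by blast
  then show thesis using crit that by blast
qed

lemma critical_min_degree:
  assumes crit: "critical W" and v: "v \<in> W"
  shows "card (nbrs E W v) \<ge> 2"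
proof (rule ccontr)
  assume "\<not> ?thesis"
  then have "card (nbrs E W v) \<le> Suc 0" by simp
  moreover have WV: "W \<subseteq> V" using crit by (simp add: critical_def)
  ultimately obtain x where x: "nbrs E W v \<subseteq> {x}"
    using card_le_Suc0_iff_eq[OF finite_nbrs_sub[OF WV]] by blast
  have "W - {v} \<subset> W" using v by blast
  then obtain c where c: "lcol (W - {v}) c"
    using crit unfolding critical_def by blast
  have nb: "nbrs E (W - {v}) v \<subseteq> {x}"
    using x nbrs_mono[of "W - {v}" W E v] by blast
  obtain b where "lcol (insert v (W - {v})) (c(v := b))"
    by (rule extend_leaf[OF c _ _ nb, of "{}"]) (use WV v mq in auto)
  then show False
    using crit v by (auto simp: critical_def insert_absorb)
qed

lemma two_nbrs:
  assumes "card (nbrs E W v) = 2" "u \<in> nbrs E W v"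
  obtains w where "nbrs E W v = {u, w}" "u \<noteq> w"
  using assms by (metis card_2_iff doubleton_eq_iff insertE singletonD)

lemma card_nbrs_remove:
  assumes "W \<subseteq> V" "v \<in> nbrs E W u" "W' \<subseteq> W - {v}"
  shows "card (nbrs E W' u) < card (nbrs E W u)"
proof -
  have "nbrs E W' u \<subset> nbrs E W u"
    using assms by (auto simp: nbrs_def)
  then show ?thesis
    using finite_nbrs_sub[OF assms(1)] psubset_card_mono by blast
qed

text \<open>After deleting \<open>v\<close>, the vertex \<open>u\<close> would have fewer than
  \<open>r\<close> colored neighbors. Used with \<open>r = 2\<close> to separate vertices of degree
  2 from each other, and with \<open>r = 3\<close> to separate them from degree 3 too.\<close>

lemma critical_light_neighbour:
  assumes crit: "critical W" and v: "v \<in> W" "card (nbrs E W v) = 2" and u: "u \<in> nbrs E W v"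
    and r: "2 \<le> r" "r \<le> 3" "m + r \<le> q"
  shows "r < card (nbrs E W u)"
proof (rule ccontr)
  assume "\<not> ?thesis"
  then have du: "card (nbrs E W u) \<le> r" by simp
  have WV: "W \<subseteq> V" using crit by (simp add: critical_def)
  obtain w where w: "nbrs E W v = {u, w}"
    using two_nbrs[OF v(2) u] .
  have "W - {v} \<subset> W" using v by blast
  then obtain c where c: "lcol (W - {v}) c"
    using crit unfolding critical_def by blast
  have nb: "nbrs E (W - {v}) v \<subseteq> {u, w}"
    using w nbrs_mono[of "W - {v}" W E v] by blast
  have lt: "card (nbrs E (W - {v}) u) < r"
    using card_nbrs_remove[OF WV nbrs_sym[OF u v(1)], of "W - {v}"] du by simp
  obtain b where "lcol (insert v (W - {v})) (c(v := b))"
    by (rule extend_path_light[OF c _ _ nb lt r]) (use WV v in auto)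
  then show False
    using crit v by (auto simp: critical_def insert_absorb)
qed

text \<open>This must work with lists of size m + 1, too short for the previous argument. The gain
  is that neither neighbor of \<open>v\<close> saturates a color, so two forbidden colors suffice,
  and \<open>q > m \<ge> 2\<close>.\<close>

lemma critical_adjacent_two_vertices:
  assumes crit: "critical W" and v: "v \<in> W" "nbrs E W v = {u, v'}" "u \<noteq> v'"
    and v': "card (nbrs E W v') = 2" and m: "m \<ge> 2"
  shows "3 < card (nbrs E W u)"
proof (rule ccontr)
  assume "\<not> ?thesis"
  then have du: "card (nbrs E W u) \<le> 3" by simp
  have WV: "W \<subseteq> V" using crit by (simp add: critical_def)
  have in_nb: "v \<in> nbrs E W u" "v \<in> nbrs E W v'"
    using nbrs_sym[of _ E W v] v(1,2) by auto
  have v'W: "v' \<in> W" using v(2) by (auto simp: nbrs_def)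
  obtain w where w: "nbrs E W v' = {v, w}"
    using two_nbrs[OF v' in_nb(2)] .
  have ne: "v \<noteq> v'" using in_nb(2) not_self by blast
  define W0 where "W0 = W - {v, v'}"
  have W0: "insert v' W0 = W - {v}"
    using ne v'W by (auto simp: W0_def)
  have "W0 \<subset> W" using v by (auto simp: W0_def)
  then obtain c0 where c0: "lcol W0 c0"
    using crit unfolding critical_def by blast
  have nb': "nbrs E W0 v' \<subseteq> {w}"
    using w nbrs_mono[of W0 W E v'] by (auto simp: W0_def nbrs_def)
  obtain b0 where c: "lcol (W - {v}) (c0(v' := b0))"
    unfolding W0[symmetric]
    by (rule extend_leaf[OF c0 _ _ nb', of "{}"]) (use WV v'W mq in \<open>auto simp: W0_def\<close>)
  define c where "c = c0(v' := b0)"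
  note c = c[folded c_def]
  \<comment> \<open>If \<open>v'\<close> and \<open>u\<close> share a color, a cycle through
    \<open>v\<close> would continue from \<open>v'\<close> to \<open>w\<close>, its only other
    neighbor; so \<open>c w\<close> takes the free second place.\<close>
  define F where "F = insert (c v') (if c v' = c u then {c w} else {c u})"
  have "card F \<le> 2"
    by (simp add: F_def card_insert_if)
  then have F: "card F < q"
    using m mq by simp
  have nb: "nbrs E (W - {v}) v \<subseteq> {v', u}"
    using v(2) nbrs_mono[of "W - {v}" W E v] by blast
  have nbv': "nbrs E (W - {v}) v' \<subseteq> {w}"
    using w by (auto simp: nbrs_def)
  \<comment> \<open>Without \<open>v\<close> at most two neighbors remain, and
    \<open>k - 1 \<ge> 3\<close>.\<close>
  have "card (nbrs E (W - {v}) y) < k - 1" if "y \<in> {v', u}" for y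
    using card_nbrs_remove[OF WV in_nb(1), of "W - {v}"]
      card_nbrs_remove[OF WV in_nb(2), of "W - {v}"] du v' k4 that by auto
  then have sat: "saturated k E (W - {v}) c y = {}" if "y \<in> {v', u}" for y
    using card_saturated_less[OF finite_sub, of "W - {v}" k E y 1 c] WV k4 that by fastforce
  obtain b where "lcol (insert v (W - {v})) (c(v := b))"
  proof (rule extend[OF c _ _ _ F _ nb])
    show "c y \<in> F \<and> saturated k E (W - {v}) c y \<subseteq> F" if "y \<in> nbrs E (W - {v}) v" for y
    proof -
      have y: "y \<in> {v', u}" using that nb by blast
      then have "c y \<in> F" by (auto simp: F_def)
      then show ?thesis using sat[OF y] by simp
    qed
    show "c ` nbrs E (W - {v}) v' \<subseteq> F" if "c v' = c u"
      using nbv' that by (auto simp: F_def)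
  qed (use WV v in \<open>auto simp: F_def\<close>)
  then show False
    using crit v by (auto simp: critical_def insert_absorb)
qed

text \<open>The vertex \<open>u\<close> is coloured first, differently from the far neighbours of all but one of the
  2-vertices in \<open>T\<close>. The exceptional 2-vertex comes next, while \<open>u\<close> has at most one other
  coloured neighbour, and the remaining ones cannot lie on a two-coloured cycle any more.\<close>

lemma critical_two_vertices_at:
  assumes crit: "critical W" and u: "u \<in> W"
    and T: "T \<subseteq> nbrs E W u" "card T = Suc s"
    and two: "\<And>v. v \<in> T \<Longrightarrow> card (nbrs E W v) = 2"
    and indep: "\<And>v y. v \<in> T \<Longrightarrow> y \<in> nbrs E W v \<Longrightarrow> card (nbrs E W y) \<noteq> 2"
    and j: "1 \<le> j" "card (nbrs E W u) \<le> j * (k - 1)" "m + j + 1 \<le> q"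
    and d: "card (nbrs E W u) = s + 2 \<and> s + m < q \<or> card (nbrs E W u) = s + 1 \<and> s < q"
  shows False
proof -
  have WV: "W \<subseteq> V" using crit by (simp add: critical_def)
  have finN: "finite (nbrs E W u)" by (rule finite_nbrs_sub[OF WV])
  have finT: "finite T" by (rule finite_subset[OF T(1) finN])
  obtain v0 T' where T': "T = insert v0 T'" "v0 \<notin> T'" "card T' = s"
    using card_Suc_eq[of T s] T(2) by blast
  have finT': "finite T'" using finT T' by simp
  have TW: "T \<subseteq> W" using T(1) by (auto simp: nbrs_def)
  have uT: "u \<notin> T" using T(1) not_self by blast
  have uN: "u \<in> nbrs E W v" if "v \<in> T" for v
    using T(1) that u by (auto intro: nbrs_sym)
  have "\<forall>v\<in>T. \<exists>w. nbrs E W v = {u, w} \<and> u \<noteq> w"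
    using two_nbrs[OF two uN] by metis
  then obtain f where f: "\<And>v. v \<in> T \<Longrightarrow> nbrs E W v = {u, f v} \<and> u \<noteq> f v"
    by metis
  have fT: "f v \<notin> T" if "v \<in> T" for v
    using f[OF that] indep[OF that, of "f v"] two[of "f v"] by auto
  define W0 where "W0 = W - insert u T"
  have W0: "W0 \<subseteq> V" "u \<in> V - W0" "W0 \<subset> W"
    using WV u by (auto simp: W0_def)
  then obtain c where c: "lcol W0 c"
    using crit unfolding critical_def by blast
  have rest: "nbrs E W0 u \<subseteq> nbrs E W u - T"
    by (auto simp: W0_def nbrs_def)
  have cardrest: "card (nbrs E W u - T) = card (nbrs E W u) - Suc s"
    using card_Diff_subset[OF finT T(1)] T(2) by simp
  \<comment> \<open>Sparing \<open>v0\<close> keeps this at \<open>s\<close> colors. In the uses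
    below, one color more could exhaust the list.\<close>
  define F where "F = c ` f ` T'"
  have F: "finite F" "card F \<le> s"
    using finT' card_image_le[of T' "c \<circ> f"] T'(3) by (auto simp: F_def image_comp)
  have "\<exists>x. nbrs E W u - T \<subseteq> {x}"
  proof -
    have "card (nbrs E W u - T) \<le> Suc 0"
      using cardrest d by auto
    then show ?thesis
      using card_le_Suc0_iff_eq[of "nbrs E W u - T"] finN by blast
  qed
  then obtain x where x: "nbrs E W u - T \<subseteq> {x}" by blast
  \<comment> \<open>The two alternatives of the degree hypothesis: if \<open>T\<close> is the whole
    neighborhood, only \<open>F\<close> restricts \<open>u\<close>; otherwise the one neighbor
    outside \<open>T\<close> blocks up to \<open>m\<close> more colors.\<close>
  obtain b where b: "b \<notin> F" "lcol (insert u W0) (c(u := b))"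
  proof (cases "nbrs E W u - T = {}")
    case True
    have lt: "card F < q" using F d mq by auto
    show thesis
      by (rule extend[OF c W0(1,2) F(1) lt, of u u]) (use True rest that in auto)
  next
    case False
    then have "card (nbrs E W u - T) \<noteq> 0" using finN by simp
    then have lt: "card F + m < q" using F d cardrest by auto
    show thesis
      by (rule extend_leaf[OF c W0(1,2) _ F(1) lt, of x]) (use x rest that in auto)
  qed
  define c1 where "c1 = c(u := b)"
  define W1 where "W1 = insert u W0"
  have c1: "lcol W1 c1" using b by (simp add: c1_def W1_def)
  have W1: "W1 = W - T"
    using u uT by (auto simp: W1_def W0_def)
  have v0: "v0 \<in> V - W1" "W1 \<subseteq> V"
    using T' TW WV by (auto simp: W1)
  have nb0: "nbrs E W1 v0 \<subseteq> {u, f v0}"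
    using f[of v0] T'(1) nbrs_mono[of W1 W E v0] by (auto simp: W1)
  \<comment> \<open>This makes \<open>u\<close> light at the moment when \<open>v0\<close>, whose
    far neighbor may share the color of \<open>u\<close>, is colored.\<close>
  have "nbrs E W1 u \<subseteq> {x}"
    using x by (auto simp: W1 nbrs_def)
  then have "card (nbrs E W1 u) \<le> card {x}"
    by (intro card_mono) auto
  then have lt: "card (nbrs E W1 u) < 2" by simp
  have q2: "m + 2 \<le> q" using j by simp
  obtain b' where b': "lcol (insert v0 W1) (c1(v0 := b'))"
    by (rule extend_path_light[OF c1 v0(2,1) nb0 lt _ _ q2]) auto
  have un: "insert v0 W1 \<union> T' = W"
    using T' TW by (auto simp: W1)
  have "colorable (insert v0 W1 \<union> T')"
  proof (rule extend_leaves[OF finT' _ _ _ b' _ _ j(3), where u = u and f = f])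
    fix v assume v: "v \<in> T'"
    then have vT: "v \<in> T" using T' by simp
    have "c (f v) \<in> F" using v by (auto simp: F_def)
    then have "b \<noteq> c (f v)" using b(1) by blast
    moreover have "f v \<noteq> u" "f v \<noteq> v0" "u \<noteq> v0" "f v \<notin> T'"
      using f[OF vT] fT[OF vT] uT T' by auto
    ultimately show "u \<in> nbrs E (insert v0 W1 \<union> T') v \<and> nbrs E (insert v0 W1 \<union> T') v \<subseteq> {u, f v}
      \<and> f v \<notin> T' \<and> (c1(v0 := b')) u \<noteq> (c1(v0 := b')) (f v)"
      unfolding un using f[OF vT] by (simp add: c1_def)
  next
    show "T' \<inter> insert v0 W1 = {}" using T' by (auto simp: W1)
    show "insert v0 W1 \<union> T' \<subseteq> V" using WV by (simp only: un)
    show "u \<in> insert v0 W1" by (simp add: W1_def)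
    show "card (nbrs E (insert v0 W1 \<union> T') u) \<le> j * (k - 1)" using j(2) by (simp only: un)
  qed
  then show False
    using crit unfolding un critical_def by blast
qed

end

subsection \<open>Discharging\<close>

text \<open>The direction of the handshake lemma needed here: an edge accounts for at most two
  ordered pairs.\<close>

lemma sum_card_nbrs:
  assumes graph: "simple_graph V E" and W: "W \<subseteq> V"
  shows "(\<Sum>v\<in>W. card (nbrs E W v)) \<le> 2 * card (induced_edges E W)"
proof -
  have finW: "finite W" by (rule finite_subset[OF W simple_graph_finite[OF graph]])
  have finI: "finite (induced_edges E W)"
    using simple_graph_finite_edges[OF graph] by (simp add: induced_edges_def)
  define A where "A = (SIGMA v:W. nbrs E W v)"
  let ?B = "\<lambda>e. {p \<in> A. {fst p, snd p} = e}"
  have finA: "finite A"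
    unfolding A_def by (rule finite_SigmaI[OF finW]) (rule finite_nbrs[OF finW])
  have sub: "A \<subseteq> (\<Union>e\<in>induced_edges E W. ?B e)"
  proof
    fix p assume p: "p \<in> A"
    then have "{snd p, fst p} \<in> E" "fst p \<in> W" "snd p \<in> W"
      by (auto simp: A_def nbrs_def)
    then have "{fst p, snd p} \<in> induced_edges E W"
      unfolding induced_edges_def by (simp add: insert_commute)
    then show "p \<in> (\<Union>e\<in>induced_edges E W. ?B e)"
      by (rule UN_I) (rule CollectI, rule conjI[OF p refl])
  qed
  have "(\<Sum>v\<in>W. card (nbrs E W v)) = card A"
    unfolding A_def by (rule card_SigmaI[symmetric]) (simp_all add: finW finite_nbrs)
  also have "\<dots> \<le> card (\<Union>e\<in>induced_edges E W. ?B e)"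
    by (rule card_mono[OF finite_subset[OF _ finA] sub]) (rule UN_least, rule Collect_restrict)
  also have "\<dots> \<le> (\<Sum>e\<in>induced_edges E W. card (?B e))"
    by (rule card_UN_le[OF finI])
  also have "\<dots> \<le> (\<Sum>e\<in>induced_edges E W. 2)"
  proof (rule sum_mono)
    fix e assume "e \<in> induced_edges E W"
    then have "e \<in> E" by (simp add: induced_edges_def)
    from bspec[OF conjunct2[OF graph[unfolded simple_graph_def]] this]
    obtain a b where e: "e = {a, b}" by (elim exE conjE)
    have "?B e \<subseteq> {(a, b), (b, a)}"
    proof
      fix p assume "p \<in> ?B e"
      then have "{fst p, snd p} = {a, b}" by (simp add: e)
      then show "p \<in> {(a, b), (b, a)}"
        by (cases p) (simp add: doubleton_eq_iff)
    qed
    then have "card (?B e) \<le> card {(a, b), (b, a)}"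
      by (rule card_mono[rotated]) simp
    also have "\<dots> \<le> 2" by (rule card_insert_le_m1) simp_all
    finally show "card (?B e) \<le> 2" .
  qed
  finally show ?thesis by simp
qed

text \<open>The subgraph induced by \<open>W\<close> competes in the maximum. Clearing the
  denominator \<open>a\<close> gives integer charges with negative total.\<close>

lemma mad_bound:
  assumes graph: "simple_graph V E" and W: "W \<subseteq> V" "W \<noteq> {}"
    and mad: "mad V E < real b / real a" and a: "a > 0"
  shows "(\<Sum>v\<in>W. int a * int (card (nbrs E W v)) - int b) < 0"
proof -
  let ?S = "{2 * real (card F) / real (card W) | W F.
      W \<subseteq> V \<and> W \<noteq> {} \<and> F \<subseteq> E \<and> (\<forall>e\<in>F. e \<subseteq> W)}"
  have finW: "finite W" by (rule finite_subset[OF W(1) simple_graph_finite[OF graph]])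
  \<comment> \<open>\<open>Max\<close> bounds its elements only for a finite set; finitely many
    pairs of subsets produce all ratios.\<close>
  have "?S \<subseteq> (\<lambda>(W, F). 2 * real (card F) / real (card W)) ` (Pow V \<times> Pow E)"
  proof
    fix t assume "t \<in> ?S"
    then obtain U F where "t = 2 * real (card F) / real (card U)" "U \<subseteq> V" "F \<subseteq> E"
      by blast
    then show "t \<in> (\<lambda>(W, F). 2 * real (card F) / real (card W)) ` (Pow V \<times> Pow E)"
      by (intro rev_image_eqI[of "(U, F)"]) auto
  qed
  then have "finite ?S"
    by (rule finite_subset)
      (simp add: simple_graph_finite[OF graph] simple_graph_finite_edges[OF graph])
  moreover have "induced_edges E W \<subseteq> E \<and> (\<forall>e\<in>induced_edges E W. e \<subseteq> W)"
    by (simp add: induced_edges_def)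
  then have "2 * real (card (induced_edges E W)) / real (card W) \<in> ?S"
    using W by blast
  ultimately have "2 * real (card (induced_edges E W)) / real (card W) \<le> mad V E"
    unfolding mad_def by (rule Max_ge)
  then have "2 * real (card (induced_edges E W)) / real (card W) < real b / real a"
    using mad by linarith
  moreover have "card W > 0" using W finW by (simp add: card_gt_0_iff)
  ultimately have "real (a * (2 * card (induced_edges E W))) < real (b * card W)"
    using a by (simp add: field_simps)
  then have "a * (2 * card (induced_edges E W)) < b * card W"
    by (simp only: of_nat_less_iff)
  moreover have "a * (\<Sum>v\<in>W. card (nbrs E W v)) \<le> a * (2 * card (induced_edges E W))"
    using sum_card_nbrs[OF graph W(1)] by simp
  ultimately have "a * (\<Sum>v\<in>W. card (nbrs E W v)) < b * card W"
    by (rule le_less_trans[rotated])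
  then have "int (a * (\<Sum>v\<in>W. card (nbrs E W v))) < int (b * card W)"
    by (simp only: of_nat_less_iff)
  then show ?thesis
    by (simp add: sum_subtractf sum_distrib_left mult.commute)
qed

text \<open>\<open>h d\<close> is the charge that a vertex of degree \<open>d\<close> sends to each neighbour of degree 2.\<close>

lemma discharging:
  fixes h :: "nat \<Rightarrow> int" and ch :: "'a \<Rightarrow> int"
  assumes fin: "finite W"
    and local: "\<And>v. v \<in> W \<Longrightarrow> h (card (nbrs E W v)) * int (card {u \<in> nbrs E W v. card (nbrs E W u) = 2})
      \<le> ch v + (if card (nbrs E W v) = 2 then \<Sum>u\<in>nbrs E W v. h (card (nbrs E W u)) else 0)"
  shows "0 \<le> (\<Sum>v\<in>W. ch v)"
proof -
  let ?d = "\<lambda>v. card (nbrs E W v)"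
  let ?g = "\<lambda>v u. if ?d u = 2 then h (?d v) else 0"
  have out: "h (?d v) * int (card {u \<in> nbrs E W v. ?d u = 2}) = (\<Sum>u\<in>nbrs E W v. ?g v u)" for v
    by (simp add: sum.If_cases finite_nbrs[OF fin] Int_def mult.commute)
  have inn: "(if ?d v = 2 then \<Sum>u\<in>nbrs E W v. h (?d u) else 0) = (\<Sum>u\<in>nbrs E W v. ?g u v)" for v
    by simp
  have nb: "{u. u \<in> W \<and> {u, v} \<in> E} = nbrs E W v" "{u. u \<in> W \<and> {v, u} \<in> E} = nbrs E W v" for v
    by (auto simp: nbrs_def insert_commute)
  \<comment> \<open>Charge sent equals charge received in total: adjacency is symmetric, so the
    double sum can be swapped and the transfers cancel.\<close>
  have "(\<Sum>v\<in>W. \<Sum>u\<in>nbrs E W v. ?g v u) = (\<Sum>u\<in>W. \<Sum>v\<in>nbrs E W u. ?g v u)"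
    using sum.swap_restrict[OF fin fin, of ?g "\<lambda>v u. {u, v} \<in> E"] unfolding nb .
  moreover have "(\<Sum>v\<in>W. \<Sum>u\<in>nbrs E W v. ?g v u) \<le> (\<Sum>v\<in>W. ch v + (\<Sum>u\<in>nbrs E W v. ?g u v))"
    by (rule sum_mono) (use local in \<open>simp only: out inn\<close>)
  ultimately show ?thesis
    by (simp add: sum.distrib)
qed

context list_instance
begin

lemma colorable_if_locally_dischargeable:
  fixes h :: "nat \<Rightarrow> int"
  assumes mad: "mad V E < real b / real a" "a > 0"
    and local: "\<And>W v. critical W \<Longrightarrow> v \<in> W \<Longrightarrow>
      h (card (nbrs E W v)) * int (card {u \<in> nbrs E W v. card (nbrs E W u) = 2})
      \<le> int a * int (card (nbrs E W v)) - int b +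
        (if card (nbrs E W v) = 2 then \<Sum>u\<in>nbrs E W v. h (card (nbrs E W u)) else 0)"
  shows "colorable V"
proof (rule ccontr)
  assume "\<not> colorable V"
  then obtain W where W: "critical W" "W \<noteq> {}" by (rule critical_exists)
  then have WV: "W \<subseteq> V" by (simp add: critical_def)
  show False
    using discharging[OF finite_sub[OF WV] local[OF W(1)]] mad_bound[OF graph WV W(2) mad] by simp
qed

section \<open>The three average degree thresholds\<close>

lemma card_nbrs_filter_le:
  "W \<subseteq> V \<Longrightarrow> card {u \<in> nbrs E W v. P u} \<le> card (nbrs E W v)"
  by (intro card_mono finite_nbrs_sub) auto

text \<open>Degree 3 has charge 3, enough for 1 per neighbor; from degree 4 on, 5d - 12 \<ge> 2d
  pays 2 per neighbor. A vertex of degree 2 receives its missing 2 either as 1 + 1, or from one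
  neighbor of degree at least 4 when the other has degree 2.\<close>

lemma colorable_mad_12_5:
  assumes mad: "mad V E < 12 / 5" and m: "m \<ge> 2"
  shows "colorable V"
proof (rule colorable_if_locally_dischargeable[where a = 5 and b = 12
      and h = "\<lambda>d. if d \<ge> 4 then 2 else if d = 3 then 1 else 0"])
  fix W v assume crit: "critical W" and v: "v \<in> W"
  let ?d = "\<lambda>v. card (nbrs E W v)" and ?h = "\<lambda>d::nat. if d \<ge> 4 then 2 else if d = 3 then 1 else (0::int)"
  have WV: "W \<subseteq> V" using crit by (simp add: critical_def)
  have le: "card {u \<in> nbrs E W v. ?d u = 2} \<le> ?d v"
    by (rule card_nbrs_filter_le[OF WV])
  have min: "?d u \<ge> 2" if "u \<in> W" for u
    by (rule critical_min_degree[OF crit that])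
  show "?h (?d v) * int (card {u \<in> nbrs E W v. ?d u = 2})
      \<le> int 5 * int (?d v) - int 12 + (if ?d v = 2 then \<Sum>u\<in>nbrs E W v. ?h (?d u) else 0)"
  proof (cases "?d v = 2")
    case False
    then show ?thesis using min[OF v] le by auto
  next
    case True
    then obtain u w where uw: "nbrs E W v = {u, w}" "u \<noteq> w"
      by (meson card_2_iff)
    have "?d u = 2 \<Longrightarrow> 3 < ?d w" "?d w = 2 \<Longrightarrow> 3 < ?d u"
      using critical_adjacent_two_vertices[OF crit v _ _ _ m, of w u]
        critical_adjacent_two_vertices[OF crit v _ _ _ m, of u w] uw by auto
    moreover have "u \<in> W" "w \<in> W" using uw by (auto simp: nbrs_def)
    then have "?d u \<ge> 2" "?d w \<ge> 2" using min by auto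
    ultimately have "?h (?d u) + ?h (?d w) \<ge> 2" by fastforce
    moreover have "(\<Sum>u\<in>nbrs E W v. ?h (?d u)) = ?h (?d u) + ?h (?d w)"
      unfolding uw(1) using uw(2) by simp
    ultimately show ?thesis using True by simp
  qed
qed (use mad in auto)

text \<open>Vertices of degree 2 are pairwise nonadjacent, so each gets 1 from both sides. From
  degree 4 on, 3d - 8 \<ge> d. Only degree 3 is tight: its charge 1 serves a single neighbor of
  degree 2, and two of them are excluded by \<open>critical_two_vertices_at\<close>.\<close>

lemma colorable_mad_8_3:
  assumes mad: "mad V E < 8 / 3" and q: "m + 2 \<le> q"
  shows "colorable V"
proof (rule colorable_if_locally_dischargeable[where a = 3 and b = 8 and h = "\<lambda>d. 1"])
  fix W v assume crit: "critical W" and v: "v \<in> W"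
  let ?d = "\<lambda>v. card (nbrs E W v)"
  have WV: "W \<subseteq> V" using crit by (simp add: critical_def)
  have light: "2 < ?d y" if "x \<in> W" "?d x = 2" "y \<in> nbrs E W x" for x y
    by (rule critical_light_neighbour[OF crit that _ _ q]) auto
  let ?A = "{u \<in> nbrs E W v. ?d u = 2}"
  have le: "card ?A \<le> ?d v"
    by (rule card_nbrs_filter_le[OF WV])
  consider "?d v = 2" | "?d v = 3" | "?d v \<ge> 4"
    using critical_min_degree[OF crit v] by linarith
  then show "1 * int (card ?A)
      \<le> int 3 * int (?d v) - int 8 + (if ?d v = 2 then \<Sum>u\<in>nbrs E W v. 1 else 0)"
  proof cases
    case 1
    have "?d u \<noteq> 2" if "u \<in> nbrs E W v" for u
      using light[OF v 1 that] by simp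
    then have A: "?A = {}" by blast
    show ?thesis unfolding A using 1 by simp
  next
    case 2
    have "card ?A \<le> 1"
    proof (rule ccontr)
      assume "\<not> ?thesis"
      then have "2 \<le> card ?A" by linarith
      then obtain T where T: "T \<subseteq> ?A" "card T = 2"
        by (rule obtain_subset_with_card_n)
      show False
      proof (rule critical_two_vertices_at[OF crit v])
        show "T \<subseteq> nbrs E W v" using T(1) by blast
        show "card T = Suc 1" using T(2) by simp
        show "?d x = 2" if "x \<in> T" for x using that T(1) by blast
        \<comment> \<open>Here \<open>k \<ge> 4\<close> gives degree 3 within \<open>k - 1\<close>,
          so \<open>j = 1\<close> and lists of size m + 2 suffice.\<close>
        show "?d v \<le> 1 * (k - 1)" using 2 k4 by simp
        show "m + 1 + 1 \<le> q" using q by simp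
        show "?d v = 1 + 2 \<and> 1 + m < q \<or> ?d v = 1 + 1 \<and> 1 < q" using 2 q by simp
        fix x y assume "x \<in> T" "y \<in> nbrs E W x"
        moreover have "x \<in> W" "?d x = 2" using \<open>x \<in> T\<close> T(1) by (auto simp: nbrs_def)
        ultimately show "?d y \<noteq> 2" using light[of x y] by simp
      qed simp
    qed
    then show ?thesis using 2 by simp
  next
    case 3
    then show ?thesis using le by simp
  qed
qed (use mad in auto)

text \<open>The charge 2d - 6 is 0, 2, 4 for d = 3, 4, 5 and at least d from 6 on. So degrees 3, 4,
  5 must have at most 0, 2, 4 neighbors of degree 2.\<close>

lemma colorable_mad_3:
  assumes mad: "mad V E < 3" and q: "m + 3 \<le> q" and m: "m \<ge> 2"
  shows "colorable V"
proof (rule colorable_if_locally_dischargeable[where a = 2 and b = 6 and h = "\<lambda>d. 1"])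
  fix W v assume crit: "critical W" and v: "v \<in> W"
  let ?d = "\<lambda>v. card (nbrs E W v)"
  have WV: "W \<subseteq> V" using crit by (simp add: critical_def)
  have light: "3 < ?d y" if "x \<in> W" "?d x = 2" "y \<in> nbrs E W x" for x y
    by (rule critical_light_neighbour[OF crit that _ _ q]) auto
  let ?A = "{u \<in> nbrs E W v. ?d u = 2}"
  have le: "card ?A \<le> ?d v"
    by (rule card_nbrs_filter_le[OF WV])
  \<comment> \<open>Degrees up to 6 are at most \<open>2 * (k - 1)\<close>, hence
    \<open>j = 2\<close> and lists of size m + 3.\<close>
  have star: False if s: "s < card ?A" "?d v = s + 2 \<and> s + m < q \<or> ?d v = s + 1 \<and> s < q" "?d v \<le> 6" for s
  proof -
    obtain T where T: "T \<subseteq> ?A" "card T = Suc s"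
      by (rule obtain_subset_with_card_n[OF Suc_leI[OF s(1)]])
    show False
    proof (rule critical_two_vertices_at[OF crit v _ T(2) _ _ _ _ _ s(2)])
      show "T \<subseteq> nbrs E W v" using T(1) by blast
      show "?d x = 2" if "x \<in> T" for x using that T(1) by blast
      show "?d v \<le> 2 * (k - 1)" using s(3) k4 by simp
      show "m + 2 + 1 \<le> q" using q by simp
      fix x y assume "x \<in> T" "y \<in> nbrs E W x"
      moreover have "x \<in> W" "?d x = 2" using \<open>x \<in> T\<close> T(1) by (auto simp: nbrs_def)
      ultimately show "?d y \<noteq> 2" using light[of x y] by simp
    qed simp
  qed
  consider "?d v = 2" | "?d v = 3" | "?d v = 4" | "?d v = 5" | "?d v \<ge> 6"
    using critical_min_degree[OF crit v] by linarith
  then show "1 * int (card ?A)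
      \<le> int 2 * int (?d v) - int 6 + (if ?d v = 2 then \<Sum>u\<in>nbrs E W v. 1 else 0)"
  proof cases
    case 1
    have "?d u \<noteq> 2" if "u \<in> nbrs E W v" for u
      using light[OF v 1 that] by simp
    then have A: "?A = {}" by blast
    show ?thesis unfolding A using 1 by simp
  next
    case 2
    have "?d u \<noteq> 2" if "u \<in> nbrs E W v" for u
      using light[of u v] nbrs_sym[OF that v] that 2 by (auto simp: nbrs_def)
    then have A: "?A = {}" by blast
    show ?thesis unfolding A using 2 by simp
  next
    case 3
    have "card ?A \<le> 2"
    proof (rule ccontr)
      assume "\<not> ?thesis"
      \<comment> \<open>Three neighbors go into \<open>T\<close> and one is left over, which costs 2
        + m colors at the center.\<close>
      then show False
        using 3 q by (intro star[of 2]) auto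
    qed
    then show ?thesis using 3 by simp
  next
    case 4
    have "card ?A \<le> 4"
    proof (rule ccontr)
      assume "\<not> ?thesis"
      \<comment> \<open>All five neighbors form \<open>T\<close>, so the center avoids only four
        colors; \<open>m \<ge> 2\<close> gives lists of size at least 5.\<close>
      then show False
        using 4 q m by (intro star[of 4]) auto
    qed
    then show ?thesis using 4 by simp
  next
    case 5
    then show ?thesis using le by simp
  qed
qed (use mad in auto)

end

subsection \<open>The choice number\<close>

text \<open>Give every vertex the same list. Around a vertex of maximum degree its own color is
  excluded, and each of the remaining \<open>q - 1\<close> colors occurs at most
  \<open>k - 1\<close> times. The conjunct \<open>q \<ge> 1\<close> guards against truncated
  subtraction.\<close>

lemma forested_choosable_lower:
  assumes graph: "simple_graph V E" and k: "k \<ge> 2" and D: "max_degree V E > 0"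
    and choos: "forested_choosable k V E q"
  shows "max_degree V E \<le> (q - 1) * (k - 1) \<and> q \<ge> 1"
proof -
  have fin: "finite V" by (rule simple_graph_finite[OF graph])
  have "max_degree V E \<in> insert 0 (degree V E ` V)"
    unfolding max_degree_def using fin by (intro Max_in) auto
  then obtain v where v: "v \<in> V" "card (nbrs E V v) = max_degree V E"
    using D by (auto simp: degree_eq_card_nbrs)
  obtain c where c: "\<forall>v\<in>V. c v \<in> {..<q}" "forested_coloring k V E c"
    using choos[unfolded forested_choosable_def, rule_format, of "\<lambda>_. {..<q}"]
    unfolding forested_L_colorable_def by auto
  have k0: "k > 0" using k by simp
  note c' = c(2)[unfolded forested_coloring_iff[OF fin k0]]
  let ?C = "\<lambda>b. {u \<in> nbrs E V v. c u = b}"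
  have "nbrs E V v \<subseteq> (\<Union>b\<in>{..<q} - {c v}. ?C b)"
  proof
    fix u assume u: "u \<in> nbrs E V v"
    then have "c u \<noteq> c v" using c' v(1) by blast
    moreover have "c u < q" using c(1) u by (auto simp: nbrs_def)
    ultimately show "u \<in> (\<Union>b\<in>{..<q} - {c v}. ?C b)" using u by simp
  qed
  then have "card (nbrs E V v) \<le> card (\<Union>b\<in>{..<q} - {c v}. ?C b)"
    by (intro card_mono) (auto simp: finite_nbrs[OF fin])
  also have "\<dots> \<le> (\<Sum>b\<in>{..<q} - {c v}. card (?C b))"
    by (rule card_UN_le) auto
  also have "\<dots> \<le> (\<Sum>b\<in>{..<q} - {c v}. k - 1)"
  proof (rule sum_mono)
    fix b
    have "card (?C b) < k" using c' v(1) by blast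
    then show "card (?C b) \<le> k - 1" by simp
  qed
  also have "\<dots> = (q - 1) * (k - 1)"
    using c(1) v(1) by simp
  finally have "max_degree V E \<le> (q - 1) * (k - 1)" by (simp only: v(2))
  moreover have "c v < q" using v(1) c(1) by blast
  ultimately show ?thesis by simp
qed

theorem theorem1p3:
  fixes V :: "'a set" and E :: "'a set set" and k :: nat
  assumes "simple_graph V E"
    and "k \<ge> 4"
    and "max_degree V E \<ge> k"
  shows "(mad V E < 12 / 5 \<longrightarrow>
            int (forested_choice_number k V E) =
              \<lceil>real (max_degree V E) / real (k - 1)\<rceil> + 1)
       \<and> (mad V E < 8 / 3 \<longrightarrow>
            int (forested_choice_number k V E) \<le>
              \<lceil>real (max_degree V E) / real (k - 1)\<rceil> + 2)
       \<and> (mad V E < 3 \<longrightarrow>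
            int (forested_choice_number k V E) \<le>
              \<lceil>real (max_degree V E) / real (k - 1)\<rceil> + 3)"
proof -
  let ?D = "max_degree V E"
  define m where "m = nat \<lceil>real ?D / real (k - 1)\<rceil>"
  have k1: "real (k - 1) > 0" using assms(2) by simp
  have m_int: "int m = \<lceil>real ?D / real (k - 1)\<rceil>"
  proof -
    have "0 \<le> real ?D / real (k - 1)" by simp
    then have "-1 < real ?D / real (k - 1)" by (rule less_le_trans[rotated]) simp
    then have "0 \<le> \<lceil>real ?D / real (k - 1)\<rceil>" by (simp only: zero_le_ceiling)
    then show ?thesis by (simp only: m_def int_nat_eq if_True)
  qed
  \<comment> \<open>The ceiling in the form used on both sides: \<open>n = m\<close> gives the
    degree bound, and \<open>n\<close> one below the choice number gives the lower bound.\<close>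
  have m_le: "m \<le> n \<longleftrightarrow> ?D \<le> n * (k - 1)" for n
  proof -
    have "m \<le> n \<longleftrightarrow> \<lceil>real ?D / real (k - 1)\<rceil> \<le> int n"
      by (simp only: m_int[symmetric] of_nat_le_iff)
    also have "\<dots> \<longleftrightarrow> real ?D / real (k - 1) \<le> real n"
      by (simp only: ceiling_le_iff of_int_of_nat_eq)
    also have "\<dots> \<longleftrightarrow> real ?D \<le> real n * real (k - 1)"
      by (rule pos_divide_le_eq[OF k1])
    also have "\<dots> \<longleftrightarrow> ?D \<le> n * (k - 1)"
      by (simp only: of_nat_mult[symmetric] of_nat_le_iff)
    finally show ?thesis .
  qed
  \<comment> \<open>Maximum degree at least \<open>k\<close> exceeds \<open>k - 1\<close>, which
    forces \<open>m \<ge> 2\<close>; the cases 12/5 and 3 rely on it.\<close>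
  have "\<not> ?D \<le> 1 * (k - 1)"
    using assms(2,3) by linarith
  then have m2: "m \<ge> 2"
    using m_le[of 1] by linarith
  have deg: "card (nbrs E V v) \<le> m * (k - 1)" if "v \<in> V" for v
  proof -
    have "degree V E v \<le> ?D"
      unfolding max_degree_def using that simple_graph_finite[OF assms(1)] by (intro Max_ge) auto
    then show ?thesis
      using m_le[of m] by (simp add: degree_eq_card_nbrs)
  qed
  have inst: "list_instance V E k m q L" if "m < q" "\<forall>v\<in>V. card (L v) = q" for q and L :: "'a \<Rightarrow> nat set"
    using assms m2 deg that by unfold_locales auto
  have choosable: "forested_choosable k V E (m + i)"
    if "mad V E < 12 / 5 \<and> i = 1 \<or> mad V E < 8 / 3 \<and> i = 2 \<or> mad V E < 3 \<and> i = 3" for i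
    unfolding forested_choosable_def
  proof (intro allI impI)
    fix L :: "'a \<Rightarrow> nat set" assume "\<forall>v\<in>V. card (L v) = m + i"
    then interpret list_instance V E k m "m + i" L
      using that by (intro inst) auto
    have "colorable V"
      using that colorable_mad_12_5 colorable_mad_8_3 colorable_mad_3 m2 by auto
    then show "forested_L_colorable k V E L"
      unfolding forested_L_colorable_def lcol_def .
  qed
  have upper: "forested_choice_number k V E \<le> n" if "forested_choosable k V E n" for n
    unfolding forested_choice_number_def using that by (rule Least_le)
  \<comment> \<open>Some choosable \<open>n\<close> must be supplied, since otherwise
    \<open>LEAST\<close> need not denote a choosable number.\<close>
  have lower: "m + 1 \<le> forested_choice_number k V E" if "forested_choosable k V E n" for n
  proof -
    have "forested_choosable k V E (forested_choice_number k V E)"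
      unfolding forested_choice_number_def using that by (rule LeastI)
    then have "?D \<le> (forested_choice_number k V E - 1) * (k - 1) \<and> forested_choice_number k V E \<ge> 1"
      using assms by (intro forested_choosable_lower) auto
    then show ?thesis
      using m_le[of "forested_choice_number k V E - 1"] by linarith
  qed
  show ?thesis
    unfolding m_int[symmetric]
    using upper[OF choosable[of 1]] upper[OF choosable[of 2]] upper[OF choosable[of 3]]
      lower[OF choosable[of 1]] by auto
qed

end
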